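(* Let $A\in\mathbb{R}^{n\times n}$ be symmetric and indefinite, $a,b\in\mathbb{R}^n$ and $\beta\in\mathbb{R}$. Consider the problem $$\min\{x^TAx+2a^Tx:\ \|x\|^2\le 1,\ b^Tx\le\beta\}.\qquad (\mathrm{eTRS})$$ Suppose there exists $\hat x\in\mathbb{R}^n$ with $\|\hat x\|^2-1<0$ and $b^T\hat x-\beta<0$. Let $x^*$ be a feasible point of (eTRS). Then $x^*$ is a global minimizer of (eTRS) if and only if there exist $\lambda_0\in\mathbb{R}$ with $\lambda_0\ge 0$, $u_0\in\mathbb{R}$ and $u\in\mathbb{R}^n$ with $(-u_0,u)\in L_{n+1}$ such that the following conditions all hold: (i) $(2A+2\lambda_0 I+bu^T+ub^T)x^*=-(2a-\beta u-bu_0)$; (ii) $\lambda_0(\|x^*\|^2-1)=0$ and $(u^Tx^*-u_0)(b^Tx^*-\beta)=0$; (iii) $2A+2\lambda_0 I+bu^T+ub^T\succeq 0$.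
   Context: $\|\cdot\|$ is the Euclidean norm on $\mathbb{R}^n$, $I$ is the $n\times n$ identity matrix, and $M\succeq 0$ means that the symmetric matrix $M$ is positive semidefinite. The Lorentz cone is $L_{n+1}=\{(x_0;\bar x)\in\mathbb{R}\times\mathbb{R}^{n}:\ \|\bar x\|\le x_0\}$; thus $(-u_0,u)\in L_{n+1}$ means $\|u\|\le -u_0$. *)

theory Defs
  imports "HOL-Analysis.Analysis"
begin

definition symmetric_mat :: "real^'n^'n \<Rightarrow> bool"
  where "symmetric_mat M \<longleftrightarrow> transpose M = M"

text \<open>As in \<open>M \<succeq> 0\<close>, symmetry is part of the notion.\<close>

definition pos_semidef :: "real^'n^'n \<Rightarrow> bool"
  where "pos_semidef M \<longleftrightarrow> symmetric_mat M \<and> (\<forall>x. 0 \<le> x \<bullet> (M *v x))"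

text \<open>Indefinite: the quadratic form takes both strictly positive and strictly negative values
  (a semidefinite matrix, including 0, is not indefinite).\<close>

definition indefinite :: "real^'n^'n \<Rightarrow> bool"
  where "indefinite M \<longleftrightarrow> (\<exists>x. 0 < x \<bullet> (M *v x)) \<and> (\<exists>y. y \<bullet> (M *v y) < 0)"

definition outer :: "real^'n \<Rightarrow> real^'n \<Rightarrow> real^'n^'n"
  where "outer v w = (\<chi> i j. v $ i * w $ j)"

definition lorentz_cone :: "(real \<times> (real^'n)) set"
  where "lorentz_cone = {(x0, xb). norm xb \<le> x0}"

definition etrs_objective :: "real^'n^'n \<Rightarrow> real^'n \<Rightarrow> real^'n \<Rightarrow> real"
  where "etrs_objective A a x = x \<bullet> (A *v x) + 2 * (a \<bullet> x)"

definition etrs_feasible :: "real^'n \<Rightarrow> real \<Rightarrow> real^'n \<Rightarrow> bool"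
  where "etrs_feasible b \<beta> x \<longleftrightarrow> (norm x)\<^sup>2 \<le> 1 \<and> b \<bullet> x \<le> \<beta>"

end

theory Submission
  imports Defs
begin

text \<open>
  Sufficiency: by (iii) the function
  \<open>f x + \<lambda>\<^sub>0 (\<parallel>x\<parallel>\<^sup>2 - 1) + (u \<bullet> x - u\<^sub>0) (b \<bullet> x - \<beta>)\<close> is convex, by (i) it is minimal at \<open>xs\<close>,
  it lies below \<open>f\<close> on the feasible set, and by (ii) it agrees with \<open>f\<close> at \<open>xs\<close>.

  Necessity starts from KKT multipliers \<open>\<mu>, \<nu> \<ge> 0\<close> of the two constraints.
  If \<open>b \<bullet> xs < \<beta>\<close> and \<open>\<parallel>xs\<parallel> = 1\<close>, then \<open>\<nu> = 0\<close> and \<open>u\<close> must be a multiple of \<open>xs\<close>; minimality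
  along rays from \<open>xs\<close>, stopped at the sphere or at the hyperplane, whichever comes first, says that
  at each point one of two quadratic forms is nonnegative, and Yuan's lemma turns this into a
  nonnegative convex combination, which determines \<open>\<lambda>\<^sub>0\<close> and \<open>u\<close>.
  If \<open>b \<bullet> xs = \<beta>\<close>, then \<open>P = A + \<mu> I\<close> is nonnegative on the orthogonal complement of \<open>b\<close>, so
  \<open>- y \<bullet> P y\<close> is concave on \<open>b \<bullet> y = - 1\<close>; minimality bounds it there by \<open>\<nu>\<close> times the gauge of
  the translated ball, and \<open>u\<close> is a linear functional separating the two functions.
\<close>

section \<open>Quadratic forms and Yuan's lemma\<close>

lemma nonneg_of_poly_nonneg:
  fixes c0 c1 c2 :: real
  assumes "\<And>e. 0 < e \<Longrightarrow> e < r \<Longrightarrow> 0 \<le> c0 + c1 * e + c2 * e\<^sup>2" and "0 < r"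
  shows "0 \<le> c0"
proof -
  have "((\<lambda>e. c0 + c1 * e + c2 * e\<^sup>2) \<longlongrightarrow> c0 + c1 * 0 + c2 * 0\<^sup>2) (at_right 0)"
    by (intro tendsto_intros)
  moreover have "eventually (\<lambda>e. 0 \<le> c0 + c1 * e + c2 * e\<^sup>2) (at_right 0)"
    using assms by (auto simp: eventually_at_right_field)
  ultimately have "0 \<le> c0 + c1 * 0 + c2 * 0\<^sup>2"
    using tendsto_lowerbound trivial_limit_at_right_real by blast
  then show ?thesis by simp
qed

lemma quadratic_form_add_scaleR:
  fixes L :: "'a::real_inner \<Rightarrow> 'a"
  assumes "linear L" and "\<And>x y. x \<bullet> L y = L x \<bullet> y"
  shows "(x + t *\<^sub>R y) \<bullet> L (x + t *\<^sub>R y) = x \<bullet> L x + 2 * t * (x \<bullet> L y) + t\<^sup>2 * (y \<bullet> L y)"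
proof -
  have "y \<bullet> L x = x \<bullet> L y"
    by (metis assms(2) inner_commute)
  then show ?thesis
    by (simp add: linear_add[OF assms(1)] linear_scale[OF assms(1)] inner_add_left inner_add_right)
      (simp add: power2_eq_square algebra_simps)
qed

text \<open>Connectedness is used twice. If every weight fails, \<open>{0..1}\<close> is covered by
  two open sets of weights, according to which form is negative at a witness of the failure; they
  share a weight \<open>t\<close>. For that \<open>t\<close>, a segment joining witnesses of both
  kinds would split into two disjoint open parts.\<close>

lemma yuan_alternative:
  fixes L0 L1 :: "'a::real_inner \<Rightarrow> 'a"
  assumes lin: "linear L0" "linear L1"
    and sym: "\<And>x y. x \<bullet> L0 y = L0 x \<bullet> y" "\<And>x y. x \<bullet> L1 y = L1 x \<bullet> y"
    and alt: "\<And>y. 0 \<le> y \<bullet> L0 y \<or> 0 \<le> y \<bullet> L1 y"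
  shows "\<exists>t\<in>{0..1}. \<forall>y. 0 \<le> (1 - t) * (y \<bullet> L0 y) + t * (y \<bullet> L1 y)"
proof (rule ccontr)
  define q where "q t y = (1 - t) * (y \<bullet> L0 y) + t * (y \<bullet> L1 y)" for t y
  assume "\<not> ?thesis"
  then have neg: "\<exists>y. q t y < 0" if "t \<in> {0..1}" for t
    using that by (auto simp: q_def not_le)
  define T0 where "T0 = (\<Union>y\<in>{y. y \<bullet> L0 y < 0}. {t. q t y < 0})"
  define T1 where "T1 = (\<Union>y\<in>{y. y \<bullet> L1 y < 0}. {t. q t y < 0})"
  have op: "open T0" "open T1"
    unfolding T0_def T1_def q_def by (intro open_UN ballI open_Collect_less continuous_intros)+
  have one_neg: "y \<bullet> L0 y < 0 \<or> y \<bullet> L1 y < 0" if "t \<in> {0..1}" "q t y < 0" for t y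
  proof (rule ccontr)
    assume "\<not> ?thesis"
    then have "0 \<le> (1 - t) * (y \<bullet> L0 y)" "0 \<le> t * (y \<bullet> L1 y)" using that(1) by simp_all
    then show False using that(2) by (simp add: q_def)
  qed
  have cover: "{0..1} \<subseteq> T0 \<union> T1"
    using neg one_neg unfolding T0_def T1_def by blast
  have "0 \<in> T0" "1 \<in> T1"
    using neg[of 0] neg[of 1] by (auto simp: T0_def T1_def q_def)
  then obtain t where t: "t \<in> {0..1}" "t \<in> T0" "t \<in> T1"
    using connectedD[OF connected_Icc op, of 0 1] cover by fastforce
  obtain y where y: "y \<bullet> L0 y < 0" "q t y < 0"
    using t by (auto simp: T0_def)
  obtain z' where z': "z' \<bullet> L1 z' < 0" "q t z' < 0"
    using t by (auto simp: T1_def)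
  define m where "m z = (1 - t) * (y \<bullet> L0 z) + t * (y \<bullet> L1 z)" for z
  \<comment> \<open>The sign of \<open>z\<close> is chosen so that \<open>q t\<close> stays negative on the segment from \<open>y\<close> to \<open>z\<close>,
    which is then covered by the two disjoint open sets where \<open>L0\<close>, resp. \<open>L1\<close>, is negative.\<close>
  obtain z where z: "z \<bullet> L1 z < 0" "q t z < 0" "m z \<le> 0"
  proof (cases "m z' \<le> 0")
    case False
    moreover have "m (- z') = - m z'" "q t (- z') = q t z'" "- z' \<bullet> L1 (- z') = z' \<bullet> L1 z'"
      using lin by (simp_all add: m_def q_def linear_neg algebra_simps)
    ultimately show ?thesis using z' that[of "- z'"] by simp
  qed (use z' that in blast)
  define p where "p s = (1 - s) *\<^sub>R y + s *\<^sub>R z" for s :: real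
  have form: "p s \<bullet> L (p s) = (1 - s)\<^sup>2 * (y \<bullet> L y) + 2 * (s * (1 - s)) * (y \<bullet> L z) + s\<^sup>2 * (z \<bullet> L z)"
    if "linear L" "\<And>x y. x \<bullet> L y = L x \<bullet> y" for L s
  proof -
    have "z \<bullet> L y = y \<bullet> L z" by (metis that(2) inner_commute)
    then show ?thesis
      using that(1)
      by (simp add: p_def linear_add linear_scale inner_add_left inner_add_right)
        (simp add: power2_eq_square algebra_simps)
  qed
  have qp: "q t (p s) < 0" if "s \<in> {0..1}" for s
  proof -
    have "q t (p s) = (1 - s)\<^sup>2 * q t y + 2 * (s * (1 - s)) * m z + s\<^sup>2 * q t z"
      unfolding q_def m_def form[OF lin(1) sym(1)] form[OF lin(2) sym(2)] by (simp add: algebra_simps)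
    moreover have "2 * (s * (1 - s)) * m z \<le> 0"
      using that z by (intro mult_nonneg_nonpos) auto
    moreover have "(1 - s)\<^sup>2 * q t y + s\<^sup>2 * q t z < 0"
    proof (cases "s = 0")
      case False
      then have "s\<^sup>2 * q t z < 0" using z by (simp add: mult_pos_neg)
      moreover have "(1 - s)\<^sup>2 * q t y \<le> 0" using y by (intro mult_nonneg_nonpos) auto
      ultimately show ?thesis by simp
    qed (use y in simp)
    ultimately show ?thesis by linarith
  qed
  define S0 where "S0 = {s. p s \<bullet> L0 (p s) < 0}"
  define S1 where "S1 = {s. p s \<bullet> L1 (p s) < 0}"
  have "open S0" "open S1"
    unfolding S0_def S1_def form[OF lin(1) sym(1)] form[OF lin(2) sym(2)]
    by (intro open_Collect_less continuous_intros)+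
  moreover have "S0 \<inter> S1 = {}"
  proof (rule equals0I)
    fix s assume "s \<in> S0 \<inter> S1"
    then show False using alt[of "p s"] by (simp add: S0_def S1_def)
  qed
  moreover have "{0..1} \<subseteq> S0 \<union> S1"
    unfolding S0_def S1_def using one_neg[OF t(1) qp] by blast
  moreover have "0 \<in> S0" "1 \<in> S1"
    using y z by (auto simp: S0_def S1_def p_def)
  ultimately show False
    using connectedD[OF connected_Icc, of S0 S1 0 1] by fastforce
qed

section \<open>First-order conditions at a minimizer\<close>

text \<open>The setting of necessity, with the matrix replaced by a self-adjoint linear map and the
  ball written with \<open>norm\<close> instead of its square.\<close>

locale extended_trs =
  fixes L :: "'a::euclidean_space \<Rightarrow> 'a" and a b xs :: 'a and \<beta> :: real
  assumes lin: "linear L" and sym: "\<And>x y. x \<bullet> L y = L x \<bullet> y"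
    and slater: "\<exists>x. norm x < 1 \<and> b \<bullet> x < \<beta>"
    and norm_xs: "norm xs \<le> 1" and b_xs: "b \<bullet> xs \<le> \<beta>"
    and minimal: "\<And>x. norm x \<le> 1 \<Longrightarrow> b \<bullet> x \<le> \<beta> \<Longrightarrow>
      xs \<bullet> L xs + 2 * (a \<bullet> xs) \<le> x \<bullet> L x + 2 * (a \<bullet> x)"
begin

lemma increment_nonneg:
  assumes "norm (xs + d) \<le> 1" and "b \<bullet> (xs + d) \<le> \<beta>"
  shows "0 \<le> d \<bullet> L d + 2 * ((L xs + a) \<bullet> d)"
  using minimal[OF assms] quadratic_form_add_scaleR[OF lin sym, of xs 1 d] sym[of xs d]
  by (simp add: inner_add_left inner_add_right)

text \<open>The segment from \<open>xs\<close> to \<open>x\<close> is feasible by convexity;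
  dividing the increment of the objective along it by \<open>e\<close> and letting \<open>e\<close>
  tend to 0 leaves the first-order term.\<close>

lemma gradient_nonneg:
  assumes "norm x \<le> 1" and "b \<bullet> x \<le> \<beta>"
  shows "0 \<le> (L xs + a) \<bullet> (x - xs)"
proof -
  have "0 \<le> 2 * ((L xs + a) \<bullet> (x - xs)) + ((x - xs) \<bullet> L (x - xs)) * e + 0 * e\<^sup>2" if e: "0 < e" "e < 1" for e
  proof -
    have eq: "xs + e *\<^sub>R (x - xs) = (1 - e) *\<^sub>R xs + e *\<^sub>R x" by (simp add: algebra_simps)
    have "norm (xs + e *\<^sub>R (x - xs)) \<le> 1"
    proof -
      have "convex (cball (0::'a) 1)" by simp
      from convexD[OF this, of xs x "1 - e" e] show ?thesis
        using assms norm_xs e by (simp add: eq)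
    qed
    moreover have "b \<bullet> (xs + e *\<^sub>R (x - xs)) \<le> \<beta>"
    proof -
      have "(1 - e) * (b \<bullet> xs) + e * (b \<bullet> x) \<le> \<beta>"
        using assms b_xs e by (intro convex_bound_le) auto
      then show ?thesis by (simp add: eq inner_add_right)
    qed
    ultimately have "0 \<le> e * (2 * ((L xs + a) \<bullet> (x - xs)) + ((x - xs) \<bullet> L (x - xs)) * e)"
      using increment_nonneg[of "e *\<^sub>R (x - xs)"]
      by (simp only: linear_scale[OF lin] inner_scaleR_left inner_scaleR_right) (simp only: algebra_simps)
    then show ?thesis using e by (simp add: zero_le_mult_iff)
  qed
  then have "0 \<le> 2 * ((L xs + a) \<bullet> (x - xs))" by (rule nonneg_of_poly_nonneg[where r=1]) auto
  then show ?thesis by simp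
qed

text \<open>With the objective linearized at \<open>xs\<close> the problem is convex and
  \<open>xs\<close> still solves it, so multipliers come from a hyperplane separating 0 from
  \<open>C\<close>; the Slater point makes the weight of the objective positive.\<close>

lemma kkt:
  obtains \<mu> \<nu> where "0 \<le> \<mu>" "0 \<le> \<nu>" "\<mu> * ((norm xs)\<^sup>2 - 1) = 0" "\<nu> * (b \<bullet> xs - \<beta>) = 0"
    "2 *\<^sub>R (L xs + a) + (2 * \<mu>) *\<^sub>R xs + \<nu> *\<^sub>R b = 0"
proof -
  define g where "g = 2 *\<^sub>R (L xs + a)"
  \<comment> \<open>Strictness matters: with weak inequalities \<open>xs\<close> itself would put 0
    into \<open>C\<close>.\<close>
  define C where "C = {w. \<exists>x. (norm x)\<^sup>2 - 1 < fst w \<and> b \<bullet> x - \<beta> < fst (snd w) \<and> g \<bullet> (x - xs) < snd (snd w)}"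
  have C0: "(0, 0, 0) \<notin> C"
  proof
    assume "(0, 0, 0) \<in> C"
    then obtain x where x: "(norm x)\<^sup>2 < 1" "b \<bullet> x < \<beta>" "g \<bullet> (x - xs) < 0" by (auto simp: C_def)
    then show False using gradient_nonneg[of x] by (simp add: g_def abs_square_less_1)
  qed
  have "convex C"
    unfolding convex_alt
  proof (intro ballI allI impI)
    fix w v and s :: real
    assume "w \<in> C" "v \<in> C" and s: "0 \<le> s \<and> s \<le> 1"
    then obtain x y where x: "(norm x)\<^sup>2 - 1 < fst w" "b \<bullet> x - \<beta> < fst (snd w)" "g \<bullet> (x - xs) < snd (snd w)"
      and y: "(norm y)\<^sup>2 - 1 < fst v" "b \<bullet> y - \<beta> < fst (snd v)" "g \<bullet> (y - xs) < snd (snd v)"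
      by (auto simp: C_def)
    have lt: "(1 - s) * p + s * q < (1 - s) * p' + s * q'" if "p < p'" "q < q'" for p q p' q' :: real
    proof (cases "s = 0")
      case False
      then have "s * q < s * q'" using s that by simp
      moreover have "(1 - s) * p \<le> (1 - s) * p'" using s that by (intro mult_left_mono) auto
      ultimately show ?thesis by simp
    qed (use that in simp)
    define z where "z = (1 - s) *\<^sub>R x + s *\<^sub>R y"
    have "(norm z)\<^sup>2 = (1 - s) * (norm x)\<^sup>2 + s * (norm y)\<^sup>2 - s * (1 - s) * (norm (x - y))\<^sup>2"
      unfolding z_def power2_norm_eq_inner
      by (simp add: inner_simps inner_commute[of y x]) (simp add: algebra_simps)
    moreover have "0 \<le> s * (1 - s) * (norm (x - y))\<^sup>2" using s by simp
    ultimately have "(norm z)\<^sup>2 - 1 \<le> (1 - s) * ((norm x)\<^sup>2 - 1) + s * ((norm y)\<^sup>2 - 1)"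
      by (simp add: algebra_simps)
    moreover have "b \<bullet> z - \<beta> = (1 - s) * (b \<bullet> x - \<beta>) + s * (b \<bullet> y - \<beta>)"
      by (simp add: z_def inner_add_right algebra_simps)
    moreover have "g \<bullet> (z - xs) = (1 - s) * (g \<bullet> (x - xs)) + s * (g \<bullet> (y - xs))"
      by (simp add: z_def inner_add_right inner_diff_right algebra_simps)
    ultimately have "(norm z)\<^sup>2 - 1 < (1 - s) * fst w + s * fst v \<and> b \<bullet> z - \<beta> < (1 - s) * fst (snd w) + s * fst (snd v)
        \<and> g \<bullet> (z - xs) < (1 - s) * snd (snd w) + s * snd (snd v)"
      using lt[OF x(1) y(1)] lt[OF x(2) y(2)] lt[OF x(3) y(3)] by linarith
    then show "(1 - s) *\<^sub>R w + s *\<^sub>R v \<in> C"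
      unfolding C_def mem_Collect_eq by (intro exI[of _ z]) simp
  qed
  then obtain k where k: "k \<noteq> 0" "\<And>w. w \<in> C \<Longrightarrow> 0 \<le> k \<bullet> w"
    using separating_hyperplane_set_0[of C] C0 by (auto simp: zero_prod_def)
  obtain k1 k2 k3 where kk: "k = (k1, k2, k3)" by (cases k) auto
  have k_nonneg: "0 \<le> k1 * r + k2 * s + k3 * t"
    if "(norm x)\<^sup>2 - 1 < r" "b \<bullet> x - \<beta> < s" "g \<bullet> (x - xs) < t" for x r s t
  proof -
    have "(r, s, t) \<in> C" using that unfolding C_def by auto
    from k(2)[OF this] show ?thesis by (simp add: kk)
  qed
  have closed: "0 \<le> k1 * r + k2 * s + k3 * t"
    if "(norm x)\<^sup>2 - 1 \<le> r" "b \<bullet> x - \<beta> \<le> s" "g \<bullet> (x - xs) \<le> t" for x r s t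
  proof (rule nonneg_of_poly_nonneg[where r=1 and ?c1.0 = "k1 + k2 + k3" and ?c2.0 = 0])
    fix e :: real assume "0 < e"
    then show "0 \<le> k1 * r + k2 * s + k3 * t + (k1 + k2 + k3) * e + 0 * e\<^sup>2"
      using k_nonneg[of x "r + e" "s + e" "t + e"] that by (simp add: algebra_simps)
  qed simp
  have lag: "0 \<le> k1 * ((norm x)\<^sup>2 - 1) + k2 * (b \<bullet> x - \<beta>) + k3 * (g \<bullet> (x - xs))" for x
    by (rule closed) auto
  have feas: "(norm xs)\<^sup>2 - 1 \<le> 0" "b \<bullet> xs - \<beta> \<le> 0"
    using norm_xs b_xs by (auto simp: abs_square_le_1)
  have pos: "0 \<le> k1" "0 \<le> k2" "0 \<le> k3"
    using closed[of xs 1 0 0] closed[of xs 0 1 0] closed[of xs 0 0 1] feas by auto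
  have zero: "r = 0 \<and> s = 0" if "r \<le> 0" "s \<le> 0" "0 \<le> r + s" for r s :: real
    using that by linarith
  \<comment> \<open>At the Slater point the two remaining terms are nonpositive with nonnegative
    sum, so both vanish and \<open>k\<close> would be 0.\<close>
  have "k3 \<noteq> 0"
  proof
    assume "k3 = 0"
    obtain x where x: "norm x < 1" "b \<bullet> x < \<beta>" using slater by blast
    then have x1: "(norm x)\<^sup>2 - 1 < 0" by (simp add: abs_square_less_1)
    have "k1 * ((norm x)\<^sup>2 - 1) \<le> 0" "k2 * (b \<bullet> x - \<beta>) \<le> 0"
      using x x1 pos by (simp_all add: mult_nonneg_nonpos)
    moreover have "0 \<le> k1 * ((norm x)\<^sup>2 - 1) + k2 * (b \<bullet> x - \<beta>)"
      using lag[of x] \<open>k3 = 0\<close> by simp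
    ultimately have "k1 * ((norm x)\<^sup>2 - 1) = 0" "k2 * (b \<bullet> x - \<beta>) = 0"
      using zero by blast+
    then have "k1 = 0" "k2 = 0" using x x1 by auto
    then show False using k \<open>k3 = 0\<close> by (simp add: kk zero_prod_def)
  qed
  then have k3: "0 < k3" using pos by simp
  have "k1 * ((norm xs)\<^sup>2 - 1) \<le> 0" "k2 * (b \<bullet> xs - \<beta>) \<le> 0"
    using feas pos by (simp_all add: mult_nonneg_nonpos)
  then have comp: "k1 * ((norm xs)\<^sup>2 - 1) = 0" "k2 * (b \<bullet> xs - \<beta>) = 0"
    using lag[of xs] zero[of "k1 * ((norm xs)\<^sup>2 - 1)" "k2 * (b \<bullet> xs - \<beta>)"] by simp_all
  \<comment> \<open>\<open>v\<close> is the gradient of the weighted Lagrangian at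
    \<open>xs\<close>; since that Lagrangian is minimal there with value 0, steps along
    \<open>- v\<close> force \<open>v = 0\<close>.\<close>
  define v where "v = (2 * k1) *\<^sub>R xs + k2 *\<^sub>R b + k3 *\<^sub>R g"
  have "0 \<le> - (v \<bullet> v) + (k1 * (v \<bullet> v)) * e + 0 * e\<^sup>2" if "0 < e" for e
  proof -
    have n: "(norm (xs - e *\<^sub>R v))\<^sup>2 = (norm xs)\<^sup>2 - 2 * e * (xs \<bullet> v) + e\<^sup>2 * (v \<bullet> v)"
      unfolding power2_norm_eq_inner
      by (simp add: inner_simps inner_commute[of v xs] power2_eq_square algebra_simps)
    have vv: "v \<bullet> v = 2 * k1 * (xs \<bullet> v) + k2 * (b \<bullet> v) + k3 * (g \<bullet> v)"
      by (subst (1) v_def) (simp add: inner_add_left)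
    have "0 \<le> k1 * ((norm xs)\<^sup>2 - 1) + k2 * (b \<bullet> xs - \<beta>) 
        + e * (k1 * (v \<bullet> v) * e - (2 * k1 * (xs \<bullet> v) + k2 * (b \<bullet> v) + k3 * (g \<bullet> v)))"
      using lag[of "xs - e *\<^sub>R v"] unfolding n
      by (simp add: inner_diff_right) (simp add: algebra_simps power2_eq_square)
    then have "0 \<le> e * (k1 * (v \<bullet> v) * e - v \<bullet> v)"
      unfolding comp vv[symmetric] by simp
    then show ?thesis using that by (simp add: zero_le_mult_iff)
  qed
  then have "0 \<le> - (v \<bullet> v)" by (rule nonneg_of_poly_nonneg[where r=1]) auto
  then have "v = 0" using inner_ge_zero[of v] by simp
  then have "(1 / k3) *\<^sub>R v = 0" by simp
  then have "g + (2 * (k1 / k3)) *\<^sub>R xs + (k2 / k3) *\<^sub>R b = 0"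
    using k3 by (simp add: v_def scaleR_add_right add.commute add.left_commute)
  then show ?thesis
    using that[of "k1 / k3" "k2 / k3"] k3 pos comp by (auto simp: g_def)
qed

section \<open>Multipliers and second-order conditions\<close>

definition stationary :: "real \<Rightarrow> real \<Rightarrow> bool"
  where "stationary \<mu> \<nu> \<longleftrightarrow> 0 \<le> \<mu> \<and> 0 \<le> \<nu> \<and> \<mu> * ((norm xs)\<^sup>2 - 1) = 0 \<and> \<nu> * (b \<bullet> xs - \<beta>) = 0 \<and>
    2 *\<^sub>R (L xs + a) + (2 * \<mu>) *\<^sub>R xs + \<nu> *\<^sub>R b = 0"

text \<open>The conditions of the theorem in terms of \<open>L\<close>: (i) has all terms on one
  side, grouped by the gradient of \<open>(u \<bullet> x - u0) * (b \<bullet> x - \<beta>)\<close>,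
  and (iii) is a quadratic form divided by 2.\<close>

definition certificate :: "real \<Rightarrow> real \<Rightarrow> 'a \<Rightarrow> bool"
  where "certificate l0 u0 u \<longleftrightarrow> 0 \<le> l0 \<and> norm u \<le> - u0 \<and>
    2 *\<^sub>R (L xs + a) + (2 * l0) *\<^sub>R xs + (u \<bullet> xs - u0) *\<^sub>R b + (b \<bullet> xs - \<beta>) *\<^sub>R u = 0 \<and>
    l0 * ((norm xs)\<^sup>2 - 1) = 0 \<and> (u \<bullet> xs - u0) * (b \<bullet> xs - \<beta>) = 0 \<and>
    (\<forall>y. 0 \<le> y \<bullet> L y + l0 * (y \<bullet> y) + (b \<bullet> y) * (u \<bullet> y))"

lemma certificate_if_psd:
  assumes "stationary \<mu> 0" and "\<And>d. 0 \<le> d \<bullet> L d + \<mu> * (d \<bullet> d)"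
  shows "certificate \<mu> 0 0"
  using assms by (simp add: stationary_def certificate_def)

lemma increment_stationary:
  assumes "stationary \<mu> \<nu>" and "norm (xs + d) \<le> 1" and "b \<bullet> (xs + d) \<le> \<beta>"
  shows "0 \<le> d \<bullet> L d - 2 * \<mu> * (xs \<bullet> d) - \<nu> * (b \<bullet> d)"
proof -
  have "(2 *\<^sub>R (L xs + a) + (2 * \<mu>) *\<^sub>R xs + \<nu> *\<^sub>R b) \<bullet> d = 0"
    using assms(1) by (simp add: stationary_def)
  then have "2 * ((L xs + a) \<bullet> d) = - 2 * \<mu> * (xs \<bullet> d) - \<nu> * (b \<bullet> d)"
    by (simp add: inner_add_left algebra_simps)
  then show ?thesis using increment_nonneg[OF assms(2,3)] by simp
qed

lemma increment_stationary_scaled: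
  assumes "stationary \<mu> \<nu>" and "norm (xs + t *\<^sub>R d) \<le> 1" and "b \<bullet> (xs + t *\<^sub>R d) \<le> \<beta>" and "0 < t"
  shows "0 \<le> t * (d \<bullet> L d) - 2 * \<mu> * (xs \<bullet> d) - \<nu> * (b \<bullet> d)"
proof -
  have "0 \<le> t * (t * (d \<bullet> L d) - 2 * \<mu> * (xs \<bullet> d) - \<nu> * (b \<bullet> d))"
    using increment_stationary[OF assms(1-3)]
    by (simp only: linear_scale[OF lin] inner_scaleR_left inner_scaleR_right) (simp only: algebra_simps)
  then show ?thesis using assms(4) by (simp add: zero_le_mult_iff)
qed

text \<open>Complementarity removes \<open>\<mu>\<close> and the product
  \<open>\<nu> * (b \<bullet> d)\<close>, so no linear term is left, and a short step along
  \<open>d\<close> stays feasible.\<close>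

lemma form_nonneg_interior:
  assumes st: "stationary \<mu> \<nu>" and "norm xs < 1" and d: "b \<bullet> xs < \<beta> \<or> b \<bullet> d = 0"
  shows "0 \<le> d \<bullet> L d + \<mu> * (d \<bullet> d)"
proof -
  have "(norm xs)\<^sup>2 < 1" using assms(2) by (simp add: abs_square_less_1)
  then have mu: "\<mu> = 0" using st by (simp add: stationary_def)
  have nu: "\<nu> * (b \<bullet> d) = 0" using st d by (auto simp: stationary_def)
  have "((\<lambda>e. norm (xs + e *\<^sub>R d)) \<longlongrightarrow> norm (xs + 0 *\<^sub>R d)) (at_right 0)"
    by (intro tendsto_intros)
  then have ev1: "eventually (\<lambda>e. norm (xs + e *\<^sub>R d) < 1) (at_right 0)"
    using assms(2) by (intro order_tendstoD) auto
  have ev2: "eventually (\<lambda>e. b \<bullet> (xs + e *\<^sub>R d) \<le> \<beta>) (at_right 0)"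
  proof (cases "b \<bullet> d = 0")
    case False
    have "((\<lambda>e. b \<bullet> (xs + e *\<^sub>R d)) \<longlongrightarrow> b \<bullet> (xs + 0 *\<^sub>R d)) (at_right 0)"
      by (intro tendsto_intros)
    then have "eventually (\<lambda>e. b \<bullet> (xs + e *\<^sub>R d) < \<beta>) (at_right 0)"
      using False d by (intro order_tendstoD) auto
    then show ?thesis by (rule eventually_mono) simp
  qed (use b_xs in \<open>simp add: inner_add_right\<close>)
  have "eventually (\<lambda>e::real. 0 < e) (at_right 0)"
    by (simp add: eventually_at_right_less)
  with ev1 ev2 have "eventually (\<lambda>e. norm (xs + e *\<^sub>R d) < 1 \<and> b \<bullet> (xs + e *\<^sub>R d) \<le> \<beta> \<and> 0 < e) (at_right 0)"
    by eventually_elim auto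
  then obtain e where e: "norm (xs + e *\<^sub>R d) < 1" "b \<bullet> (xs + e *\<^sub>R d) \<le> \<beta>" "0 < e"
    using eventually_happens trivial_limit_at_right_real by blast
  have "0 \<le> e * (d \<bullet> L d)"
    using increment_stationary_scaled[OF st _ e(2,3)] e(1) mu nu by simp
  then show ?thesis using e mu by (simp add: zero_le_mult_iff)
qed

text \<open>The bound on \<open>t\<close> keeps the step from passing the second point where the
  line meets the sphere.\<close>

lemma chord_norm_le:
  assumes "norm xs = 1" and "0 \<le> t" and "t * (d \<bullet> d) \<le> - 2 * (xs \<bullet> d)"
  shows "norm (xs + t *\<^sub>R d) \<le> 1"
proof -
  have "xs \<bullet> xs = 1" using assms(1) by (simp add: norm_eq_1)
  then have "(norm (xs + t *\<^sub>R d))\<^sup>2 = 1 + t * (2 * (xs \<bullet> d) + t * (d \<bullet> d))"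
    unfolding power2_norm_eq_inner by (simp add: inner_simps inner_commute[of d xs] algebra_simps)
  moreover have "t * (2 * (xs \<bullet> d) + t * (d \<bullet> d)) \<le> 0"
    using assms by (intro mult_nonneg_nonpos) auto
  ultimately have "(norm (xs + t *\<^sub>R d))\<^sup>2 \<le> 1" by linarith
  then show ?thesis by (simp only: abs_square_le_1 abs_norm_cancel)
qed

lemma shifted_form_add_scaleR:
  "(x + t *\<^sub>R y) \<bullet> L (x + t *\<^sub>R y) + \<mu> * ((x + t *\<^sub>R y) \<bullet> (x + t *\<^sub>R y)) =
    (x \<bullet> L x + \<mu> * (x \<bullet> x)) + 2 * (x \<bullet> L y + \<mu> * (x \<bullet> y)) * t + (y \<bullet> L y + \<mu> * (y \<bullet> y)) * t\<^sup>2"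
  unfolding quadratic_form_add_scaleR[OF lin sym]
  by (simp add: inner_simps inner_commute[of y x]) (simp add: algebra_simps power2_eq_square)

text \<open>A direction pointing into the ball is followed to the second point on the sphere, where
  \<open>- 2 * \<mu> * (xs \<bullet> d)\<close> becomes \<open>t * \<mu> * (d \<bullet> d)\<close>
  and completes the shifted form; \<open>dir\<close> keeps the step feasible and removes
  \<open>\<nu>\<close>. Outward directions are negated, tangent ones perturbed by
  \<open>w\<close>.\<close>

lemma form_nonneg_on_subspace:
  assumes st: "stationary \<mu> \<nu>" and "norm xs = 1" and S: "subspace S"
    and dir: "\<And>d. d \<in> S \<Longrightarrow> xs \<bullet> d < 0 \<Longrightarrow> b \<bullet> d \<le> 0 \<and> \<nu> * (b \<bullet> d) = 0"
    and w: "w \<in> S" "xs \<bullet> w \<noteq> 0" and "d \<in> S"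
  shows "0 \<le> d \<bullet> L d + \<mu> * (d \<bullet> d)"
proof -
  have neg: "0 \<le> v \<bullet> L v + \<mu> * (v \<bullet> v)" if v: "v \<in> S" "xs \<bullet> v < 0" for v
  proof -
    have vv: "0 < v \<bullet> v" using v by auto
    define t where "t = - 2 * (xs \<bullet> v) / (v \<bullet> v)"
    have t: "0 < t" "t * (v \<bullet> v) = - 2 * (xs \<bullet> v)" using vv v by (auto simp: t_def divide_neg_pos)
    have "norm (xs + t *\<^sub>R v) \<le> 1" using t assms(2) by (intro chord_norm_le) auto
    moreover have "t * (b \<bullet> v) \<le> 0"
      using t dir[OF v] by (simp add: mult_nonneg_nonpos)
    then have "b \<bullet> (xs + t *\<^sub>R v) \<le> \<beta>"
      using b_xs by (simp add: inner_add_right)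
    ultimately have "0 \<le> t * (v \<bullet> L v) - 2 * \<mu> * (xs \<bullet> v)"
      using increment_stationary_scaled[OF st _ _ t(1), of v] dir[OF v] by auto
    also have "\<dots> = t * (v \<bullet> L v) + \<mu> * (t * (v \<bullet> v))" by (simp add: t(2))
    also have "\<dots> = t * (v \<bullet> L v + \<mu> * (v \<bullet> v))" by (simp add: algebra_simps)
    finally show ?thesis using t(1) by (simp add: zero_le_mult_iff)
  qed
  have nz: "0 \<le> v \<bullet> L v + \<mu> * (v \<bullet> v)" if v: "v \<in> S" "xs \<bullet> v \<noteq> 0" for v
  proof (cases "xs \<bullet> v < 0")
    case False
    then show ?thesis
      using neg[of "- v"] v S lin by (simp add: subspace_neg linear_neg)
  qed (use neg v in blast)
  show ?thesis
  proof (cases "xs \<bullet> d = 0")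
    case True
    have "0 \<le> (d \<bullet> L d + \<mu> * (d \<bullet> d)) + 2 * (d \<bullet> L w + \<mu> * (d \<bullet> w)) * e + (w \<bullet> L w + \<mu> * (w \<bullet> w)) * e\<^sup>2"
      if "0 < e" for e
      unfolding shifted_form_add_scaleR[symmetric]
      using S w \<open>d \<in> S\<close> True that
      by (intro nz subspace_add subspace_scale) (auto simp: inner_add_right)
    then show ?thesis by (rule nonneg_of_poly_nonneg[where r=1]) auto
  qed (use nz \<open>d \<in> S\<close> in blast)
qed

section \<open>Inactive linear constraint\<close>

text \<open>Complementarity forces \<open>u \<bullet> xs = u0 \<le> - norm u\<close>. On the sphere
  this is equality in Cauchy-Schwarz, hence \<open>u = u0 *\<^sub>R xs\<close>, and only the
  splitting of \<open>\<mu>\<close> between \<open>l0\<close> and \<open>u0\<close> remains to be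
  chosen.\<close>

lemma certificate_inactive:
  assumes inactive: "b \<bullet> xs < \<beta>"
  shows "\<exists>l0 u0 u. certificate l0 u0 u"
proof -
  obtain \<mu> \<nu> where st: "stationary \<mu> \<nu>"
    using kkt unfolding stationary_def by metis
  moreover have "\<nu> = 0" using st inactive by (simp add: stationary_def)
  ultimately have st: "stationary \<mu> 0" by simp
  show ?thesis
  proof (cases "norm xs < 1")
    case True
    then show ?thesis
      using certificate_if_psd[OF st] form_nonneg_interior[OF st True] inactive by blast
  next
    case False
    then have xs1: "norm xs = 1" using norm_xs by simp
    then have xsxs: "xs \<bullet> xs = 1" by (simp add: norm_eq_1)
    have mu: "0 \<le> \<mu>" and grad: "2 *\<^sub>R (L xs + a) + (2 * \<mu>) *\<^sub>R xs = 0"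
      using st by (auto simp: stationary_def)
    define \<delta> where "\<delta> = \<beta> - b \<bullet> xs"
    have \<delta>: "0 < \<delta>" using inactive by (simp add: \<delta>_def)
    \<comment> \<open>Scaled so that \<open>\<mu> = k * r * (b \<bullet> d)\<close> when the ray
      along \<open>d\<close> meets the hyperplane at parameter \<open>r\<close>; this turns the
      linear term into a quadratic one.\<close>
    define k where "k = \<mu> / \<delta>"
    have k: "0 \<le> k" "k * \<delta> = \<mu>" using mu \<delta> by (auto simp: k_def)
    \<comment> \<open>\<open>P0\<close> governs the rays from \<open>xs\<close> that meet the sphere first, \<open>P1\<close> those that meet the hyperplane first.\<close>
    define P0 where "P0 d = L d + \<mu> *\<^sub>R d" for d
    define P1 where "P1 d = L d - k *\<^sub>R ((b \<bullet> d) *\<^sub>R xs + (xs \<bullet> d) *\<^sub>R b)" for d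
    have linP: "linear P0" "linear P1"
      unfolding P0_def P1_def using lin
      by (auto intro!: linearI simp: linear_add linear_scale inner_add_right algebra_simps)
    have symP: "x \<bullet> P0 y = P0 x \<bullet> y" "x \<bullet> P1 y = P1 x \<bullet> y" for x y
      using sym[of x y] by (simp_all add: P0_def P1_def inner_simps inner_commute[of x] algebra_simps)
    have P0: "d \<bullet> P0 d = d \<bullet> L d + \<mu> * (d \<bullet> d)" for d
      by (simp add: P0_def inner_add_right)
    have P1: "d \<bullet> P1 d = d \<bullet> L d - 2 * k * ((xs \<bullet> d) * (b \<bullet> d))" for d
      by (simp add: P1_def inner_simps inner_commute[of d] algebra_simps)
    have alt_neg: "0 \<le> d \<bullet> P0 d \<or> 0 \<le> d \<bullet> P1 d" if p: "xs \<bullet> d < 0" for d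
    proof -
      have dd: "0 < d \<bullet> d" using p by auto
      define t where "t = - 2 * (xs \<bullet> d) / (d \<bullet> d)"
      have t: "0 < t" "t * (d \<bullet> d) = - 2 * (xs \<bullet> d)" using dd p by (auto simp: t_def divide_neg_pos)
      show ?thesis
      proof (cases "t * (b \<bullet> d) \<le> \<delta>")
        case True
        have "0 \<le> t * (d \<bullet> L d) - 2 * \<mu> * (xs \<bullet> d)"
          using increment_stationary_scaled[OF st _ _ t(1)] chord_norm_le[OF xs1, of t d] t True
          by (simp add: \<delta>_def inner_add_right)
        also have "\<dots> = t * (d \<bullet> L d) + \<mu> * (t * (d \<bullet> d))" by (simp add: t(2))
        also have "\<dots> = t * (d \<bullet> P0 d)" by (simp add: P0 algebra_simps)
        finally show ?thesis using t(1) by (simp add: zero_le_mult_iff)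
      next
        case False
        then have "0 < t * (b \<bullet> d)" using \<delta> by linarith
        then have bd: "0 < b \<bullet> d" using t(1) by (simp add: zero_less_mult_iff)
        define r where "r = \<delta> / (b \<bullet> d)"
        have r: "0 < r" "r * (b \<bullet> d) = \<delta>" using bd \<delta> by (auto simp: r_def)
        have "r < t" using False bd by (simp add: r_def field_simps)
        then have "r * (d \<bullet> d) \<le> t * (d \<bullet> d)" using dd by simp
        then have "norm (xs + r *\<^sub>R d) \<le> 1"
          using r t by (intro chord_norm_le[OF xs1]) auto
        then have "0 \<le> r * (d \<bullet> L d) - 2 * \<mu> * (xs \<bullet> d)"
          using increment_stationary_scaled[OF st _ _ r(1), of d] r by (simp add: \<delta>_def inner_add_right)
        also have "\<dots> = r * (d \<bullet> L d) - 2 * (k * (r * (b \<bullet> d))) * (xs \<bullet> d)" by (simp add: r(2) k(2))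
        also have "\<dots> = r * (d \<bullet> P1 d)" by (simp add: P1 algebra_simps)
        finally show ?thesis using r(1) by (simp add: zero_le_mult_iff)
      qed
    qed
    have alt_nz: "0 \<le> d \<bullet> P0 d \<or> 0 \<le> d \<bullet> P1 d" if "xs \<bullet> d \<noteq> 0" for d
      using alt_neg[of d] alt_neg[of "- d"] that linP by (fastforce simp: linear_neg)
    have alt: "0 \<le> d \<bullet> P0 d \<or> 0 \<le> d \<bullet> P1 d" for d
    proof (cases "xs \<bullet> d = 0")
      case True
      show ?thesis
      proof (rule ccontr)
        assume "\<not> ?thesis"
        then have lt: "d \<bullet> P0 d < 0" "d \<bullet> P1 d < 0" by auto
        \<comment> \<open>A tangent direction is tilted by a small multiple of \<open>xs\<close>:
          both forms stay negative by continuity, while the product with \<open>xs\<close> becomes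
          \<open>e > 0\<close>, a case already settled.\<close>
        have "((\<lambda>e. (d + e *\<^sub>R xs) \<bullet> P (d + e *\<^sub>R xs)) \<longlongrightarrow> (d + 0 *\<^sub>R xs) \<bullet> P (d + 0 *\<^sub>R xs)) (at_right 0)"
          if "linear P" for P :: "'a \<Rightarrow> 'a"
          using that by (intro tendsto_inner bounded_linear.tendsto[of P] tendsto_intros)
            (simp_all add: linear_conv_bounded_linear)
        then have ev: "eventually (\<lambda>e. (d + e *\<^sub>R xs) \<bullet> P (d + e *\<^sub>R xs) < 0) (at_right 0)"
          if "linear P" "d \<bullet> P d < 0" for P
          using that by (intro order_tendstoD) auto
        have "eventually (\<lambda>e::real. 0 < e) (at_right 0)"
          by (simp add: eventually_at_right_less)
        with ev[OF linP(1) lt(1)] ev[OF linP(2) lt(2)]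
        have "eventually (\<lambda>e. (d + e *\<^sub>R xs) \<bullet> P0 (d + e *\<^sub>R xs) < 0 \<and>
            (d + e *\<^sub>R xs) \<bullet> P1 (d + e *\<^sub>R xs) < 0 \<and> 0 < e) (at_right 0)"
          by eventually_elim auto
        then obtain e where "(d + e *\<^sub>R xs) \<bullet> P0 (d + e *\<^sub>R xs) < 0"
            "(d + e *\<^sub>R xs) \<bullet> P1 (d + e *\<^sub>R xs) < 0" "0 < e"
          using eventually_happens trivial_limit_at_right_real by blast
        moreover have "xs \<bullet> (d + e *\<^sub>R xs) = e" by (simp add: inner_add_right True xsxs)
        ultimately show False using alt_nz[of "d + e *\<^sub>R xs"] by auto
      qed
    qed (use alt_nz in blast)
    obtain s where s: "0 \<le> s" "s \<le> 1" "\<And>y. 0 \<le> (1 - s) * (y \<bullet> P0 y) + s * (y \<bullet> P1 y)"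
      using yuan_alternative[OF linP symP alt] by auto
    \<comment> \<open>These weights make the convex combination of the two forms the one in the
      certificate, and \<open>2 * l0 + \<sigma> * \<delta> = 2 * \<mu>\<close> preserves
      stationarity.\<close>
    define l0 where "l0 = (1 - s) * \<mu>"
    define \<sigma> where "\<sigma> = 2 * s * k"
    have l0: "0 \<le> l0" using s mu by (simp add: l0_def)
    have \<sigma>: "0 \<le> \<sigma>" "\<sigma> * \<delta> = 2 * s * \<mu>" using s k by (auto simp: \<sigma>_def)
    have "certificate l0 (- \<sigma>) (- \<sigma> *\<^sub>R xs)"
      unfolding certificate_def
    proof (intro conjI allI)
      have "(b \<bullet> xs - \<beta>) *\<^sub>R (- \<sigma> *\<^sub>R xs) = (2 * s * \<mu>) *\<^sub>R xs"
        using \<sigma>(2) by (simp add: \<delta>_def algebra_simps flip: scaleR_left.diff)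
      then show "2 *\<^sub>R (L xs + a) + (2 * l0) *\<^sub>R xs + ((- \<sigma> *\<^sub>R xs) \<bullet> xs - - \<sigma>) *\<^sub>R b +
          (b \<bullet> xs - \<beta>) *\<^sub>R (- \<sigma> *\<^sub>R xs) = 0"
        using grad by (simp add: xsxs l0_def algebra_simps)
      fix y
      have "(1 - s) * (y \<bullet> P0 y) + s * (y \<bullet> P1 y) =
          y \<bullet> L y + l0 * (y \<bullet> y) + (b \<bullet> y) * ((- \<sigma> *\<^sub>R xs) \<bullet> y)"
        by (simp add: P0 P1 l0_def \<sigma>_def algebra_simps)
      then show "0 \<le> y \<bullet> L y + l0 * (y \<bullet> y) + (b \<bullet> y) * ((- \<sigma> *\<^sub>R xs) \<bullet> y)"
        using s(3)[of y] by simp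
    qed (use l0 \<sigma> xs1 xsxs in auto)
    then show ?thesis by blast
  qed
qed

section \<open>Active linear constraint\<close>

text \<open>With \<open>u0 = u \<bullet> xs - \<nu>\<close> the first bound is the cone condition.
  It is equivalent to \<open>- \<nu> \<le> u \<bullet> y\<close> on the unit ball translated by
  \<open>- xs\<close>, which is what the separation yields.\<close>

lemma separating_multiplier:
  assumes st: "stationary \<mu> \<nu>" and active: "b \<bullet> xs = \<beta>"
    and psd: "\<And>d. b \<bullet> d = 0 \<Longrightarrow> 0 \<le> d \<bullet> L d + \<mu> * (d \<bullet> d)"
  shows "\<exists>u. norm u + u \<bullet> xs \<le> \<nu> \<and> (\<forall>y. 0 \<le> y \<bullet> L y + \<mu> * (y \<bullet> y) + (b \<bullet> y) * (u \<bullet> y))"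
proof -
  define Q where "Q y = y \<bullet> L y + \<mu> * (y \<bullet> y)" for y
  have mu: "0 \<le> \<mu>" "\<mu> \<noteq> 0 \<Longrightarrow> norm xs = 1" and nu: "0 \<le> \<nu>"
    using st norm_xs abs_square_eq_1[of "norm xs"] by (auto simp: stationary_def)
  have Qscale: "Q (t *\<^sub>R y) = t\<^sup>2 * Q y" for t y
    by (simp add: Q_def linear_scale[OF lin] power2_eq_square algebra_simps)
  have ray: "0 \<le> Q d - \<nu> * (b \<bullet> d)" if d: "norm (xs + d) \<le> 1" "b \<bullet> d < 0" for d
  proof (cases "\<mu> = 0")
    case True
    then show ?thesis
      using increment_stationary[OF st d(1)] d(2) active by (simp add: Q_def inner_add_right)
  next
    case False
    then have xs1: "norm xs = 1" by (rule mu)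
    have dd: "0 < d \<bullet> d" using d by auto
    \<comment> \<open>The step is prolonged to the sphere, at a parameter \<open>t \<ge> 1\<close>,
      to complete the shifted form; the surplus multiple of \<open>\<nu> * (b \<bullet> d)\<close>
      has the favourable sign.\<close>
    define t where "t = - 2 * (xs \<bullet> d) / (d \<bullet> d)"
    have t: "t * (d \<bullet> d) = - 2 * (xs \<bullet> d)" using dd by (auto simp: t_def)
    have "(norm (xs + d))\<^sup>2 \<le> 1" using d(1) by (simp add: abs_square_le_1)
    then have "d \<bullet> d \<le> - 2 * (xs \<bullet> d)"
      using xs1 unfolding power2_norm_eq_inner by (simp add: inner_simps inner_commute[of d xs] norm_eq_1)
    then have "1 * (d \<bullet> d) \<le> t * (d \<bullet> d)" by (simp add: t)
    then have t1: "1 \<le> t" using dd by (simp only: mult_le_cancel_right_pos)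
    have "0 \<le> t * (d \<bullet> L d) - 2 * \<mu> * (xs \<bullet> d) - \<nu> * (b \<bullet> d)"
    proof (rule increment_stationary_scaled[OF st])
      show "norm (xs + t *\<^sub>R d) \<le> 1" using t1 t by (intro chord_norm_le[OF xs1]) auto
      show "b \<bullet> (xs + t *\<^sub>R d) \<le> \<beta>"
        using d(2) t1 active by (simp add: inner_add_right mult_nonneg_nonpos)
    qed (use t1 in simp)
    also have "\<dots> = t * (d \<bullet> L d) + \<mu> * (t * (d \<bullet> d)) - \<nu> * (b \<bullet> d)" by (simp add: t)
    also have "\<dots> = t * (Q d - \<nu> * (b \<bullet> d)) - (1 - t) * (\<nu> * (b \<bullet> d))" by (simp add: Q_def algebra_simps)
    finally have "(1 - t) * (\<nu> * (b \<bullet> d)) \<le> t * (Q d - \<nu> * (b \<bullet> d))" by simp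
    moreover have "0 \<le> (1 - t) * (\<nu> * (b \<bullet> d))"
      using t1 nu d(2) by (intro mult_nonpos_nonpos) (auto simp: mult_nonneg_nonpos)
    ultimately have "0 \<le> t * (Q d - \<nu> * (b \<bullet> d))" by linarith
    then show ?thesis using t1 by (simp add: zero_le_mult_iff)
  qed
  \<comment> \<open>\<open>C1\<close> is the strict epigraph of \<open>\<nu>\<close> times the gauge of the unit ball translated by \<open>- xs\<close>.\<close>
  define C1 where "C1 = {w. \<exists>\<tau>. norm (fst w + \<tau> *\<^sub>R xs) \<le> \<tau> \<and> \<tau> * \<nu> < snd w}"
  define C2 where "C2 = {w. b \<bullet> fst w = - 1 \<and> snd w \<le> - Q (fst w)}"
  have add: "w + v \<in> C1" if wv: "w \<in> C1" "v \<in> C1" for w v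
  proof -
    obtain \<tau> \<rho> where "norm (fst w + \<tau> *\<^sub>R xs) \<le> \<tau>" "\<tau> * \<nu> < snd w" "norm (fst v + \<rho> *\<^sub>R xs) \<le> \<rho>" "\<rho> * \<nu> < snd v"
      using wv by (auto simp: C1_def)
    then have "norm ((fst w + \<tau> *\<^sub>R xs) + (fst v + \<rho> *\<^sub>R xs)) \<le> \<tau> + \<rho>" "(\<tau> + \<rho>) * \<nu> < snd w + snd v"
      by (auto simp: distrib_right intro: norm_triangle_mono)
    then show ?thesis
      unfolding C1_def mem_Collect_eq
      by (intro exI[of _ "\<tau> + \<rho>"]) (simp add: algebra_simps)
  qed
  have scale: "k *\<^sub>R w \<in> C1" if wk: "w \<in> C1" "0 < k" for w k
  proof -
    obtain \<tau> where \<tau>: "norm (fst w + \<tau> *\<^sub>R xs) \<le> \<tau>" "\<tau> * \<nu> < snd w"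
      using wk by (auto simp: C1_def)
    have "fst (k *\<^sub>R w) + (k * \<tau>) *\<^sub>R xs = k *\<^sub>R (fst w + \<tau> *\<^sub>R xs)" by (simp add: algebra_simps)
    then have "norm (fst (k *\<^sub>R w) + (k * \<tau>) *\<^sub>R xs) \<le> k * \<tau>" using \<tau> that by simp
    moreover have "(k * \<tau>) * \<nu> < snd (k *\<^sub>R w)" using \<tau> that by (simp add: mult.assoc)
    ultimately show ?thesis unfolding C1_def by blast
  qed
  have "convex C1"
    unfolding convex_alt
  proof (intro ballI allI impI)
    fix w v and k :: real
    assume "w \<in> C1" "v \<in> C1" "0 \<le> k \<and> k \<le> 1"
    then show "(1 - k) *\<^sub>R w + k *\<^sub>R v \<in> C1"
      by (cases "k = 0"; cases "k = 1") (simp_all add: add scale)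
  qed
  \<comment> \<open>Two points of the hyperplane \<open>b \<bullet> y = - 1\<close> differ by a
    vector orthogonal to \<open>b\<close>, where \<open>Q\<close> is nonnegative; so
    \<open>Q\<close> is convex on that hyperplane.\<close>
  have "convex C2"
    unfolding convex_alt
  proof (intro ballI allI impI)
    fix w v and k :: real
    assume wv: "w \<in> C2" "v \<in> C2" and k: "0 \<le> k \<and> k \<le> 1"
    define x y where "x = fst w" and "y = fst v"
    have x: "b \<bullet> x = -1" "snd w \<le> - Q x" and y: "b \<bullet> y = -1" "snd v \<le> - Q y"
      using wv by (auto simp: C2_def x_def y_def)
    have "Q (x + k *\<^sub>R (y - x)) = (1 - k) * Q x + k * Q (x + 1 *\<^sub>R (y - x)) - k * (1 - k) * Q (y - x)"
      unfolding Q_def shifted_form_add_scaleR by (simp add: algebra_simps power2_eq_square)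
    moreover have "0 \<le> k * (1 - k) * Q (y - x)"
      using k psd[of "y - x"] x y by (simp add: Q_def inner_diff_right)
    ultimately have "Q (x + k *\<^sub>R (y - x)) \<le> (1 - k) * Q x + k * Q y" by simp
    moreover have "(1 - k) * snd w \<le> (1 - k) * - Q x" "k * snd v \<le> k * - Q y"
      using k x y by (intro mult_left_mono; simp)+
    moreover have "fst ((1 - k) *\<^sub>R w + k *\<^sub>R v) = x + k *\<^sub>R (y - x)"
      by (simp add: x_def y_def algebra_simps)
    ultimately show "(1 - k) *\<^sub>R w + k *\<^sub>R v \<in> C2"
      using x y by (simp add: C2_def inner_add_right inner_diff_right)
  qed
  obtain xh where xh: "norm xh < 1" "b \<bullet> xh < \<beta>" using slater by blast
  define e where "e = xh - xs"
  have be: "b \<bullet> e < 0" using xh active by (simp add: e_def inner_diff_right)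
  define e' where "e' = (1 / - (b \<bullet> e)) *\<^sub>R e"
  have be': "b \<bullet> e' = - 1" using be by (simp add: e'_def)
  have "(e', - Q e') \<in> C2" using be' by (simp add: C2_def)
  then have "C2 \<noteq> {}" by blast
  moreover have "(0, 1) \<in> C1" unfolding C1_def mem_Collect_eq by (intro exI[of _ 0]) simp
  then have "C1 \<noteq> {}" by blast
  \<comment> \<open>Dividing a common point by \<open>\<tau>\<close> gives a feasible increment
    \<open>d\<close>; the inequality \<open>ray\<close>, rescaled by \<open>\<tau>\<^sup>2\<close>,
    contradicts the two bounds on \<open>snd w\<close>.\<close>
  moreover have "C2 \<inter> C1 = {}"
  proof (rule equals0I)
    fix w assume "w \<in> C2 \<inter> C1"
    then obtain \<tau> where w: "b \<bullet> fst w = - 1" "snd w \<le> - Q (fst w)" "norm (fst w + \<tau> *\<^sub>R xs) \<le> \<tau>" "\<tau> * \<nu> < snd w"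
      by (auto simp: C1_def C2_def)
    have "0 \<le> \<tau>" using w(3) norm_ge_zero order_trans by blast
    moreover have "\<tau> \<noteq> 0" using w by auto
    ultimately have \<tau>: "0 < \<tau>" by simp
    define d where "d = (1 / \<tau>) *\<^sub>R fst w"
    have fw: "fst w = \<tau> *\<^sub>R d" using \<tau> by (simp add: d_def)
    have "\<tau> * norm (xs + d) = norm (fst w + \<tau> *\<^sub>R xs)"
      using \<tau> by (simp add: fw add.commute flip: scaleR_add_right)
    then have "norm (xs + d) \<le> 1" using w(3) \<tau> by (metis mult.right_neutral mult_le_cancel_left_pos)
    moreover have bd: "\<tau> * (b \<bullet> d) = - 1" using w(1) by (simp add: fw)
    then have "b \<bullet> d < 0" using \<tau> by (metis mult_less_0_iff neg_less_0_iff_less not_less_iff_gr_or_eq zero_less_one)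
    ultimately have "0 \<le> Q d - \<nu> * (b \<bullet> d)" by (rule ray)
    then have "0 \<le> \<tau>\<^sup>2 * (Q d - \<nu> * (b \<bullet> d))" by simp
    also have "\<dots> = Q (fst w) - \<tau> * \<nu> * (\<tau> * (b \<bullet> d))"
      by (simp add: fw Qscale algebra_simps power2_eq_square)
    finally show False using w(2,4) unfolding bd by simp
  qed
  ultimately obtain n c where n: "n \<noteq> 0" and nC2: "\<And>w. w \<in> C2 \<Longrightarrow> n \<bullet> w \<le> c" and nC1: "\<And>w. w \<in> C1 \<Longrightarrow> c \<le> n \<bullet> w"
    using separating_hyperplane_sets[OF \<open>convex C2\<close> \<open>convex C1\<close>] by blast
  obtain p q where pq: "n = (p, q)" by (cases n)
  \<comment> \<open>\<open>C1\<close> is closed under positive scaling, so a functional bounded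
    below on it cannot be negative there.\<close>
  have cone: "0 \<le> n \<bullet> w" if "w \<in> C1" for w
  proof (rule ccontr)
    assume neg: "\<not> 0 \<le> n \<bullet> w"
    define k where "k = (\<bar>c\<bar> + 1) / - (n \<bullet> w)"
    have "0 < k" using neg unfolding k_def by (intro divide_pos_pos) linarith+
    from nC1[OF scale[OF that this]] have "c \<le> k * (n \<bullet> w)" by simp
    also have "\<dots> = - (\<bar>c\<bar> + 1)" using neg by (simp add: k_def field_simps)
    finally show False by linarith
  qed
  have C1I: "(y, s) \<in> C1" if "norm (y + \<tau> *\<^sub>R xs) \<le> \<tau>" "\<tau> * \<nu> < s" for y s \<tau>
    using that by (auto simp: C1_def)
  have q0: "0 \<le> q" using cone[OF C1I[of 0 0 1]] by (simp add: pq)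
  have pC1: "0 \<le> p \<bullet> y + q * (\<tau> * \<nu>)" if "norm (y + \<tau> *\<^sub>R xs) \<le> \<tau>" for y \<tau>
  proof (rule nonneg_of_poly_nonneg[where r=1 and ?c1.0 = q and ?c2.0 = 0])
    fix e :: real assume "0 < e"
    then show "0 \<le> p \<bullet> y + q * (\<tau> * \<nu>) + q * e + 0 * e\<^sup>2"
      using cone[OF C1I[OF that, of "\<tau> * \<nu> + e"]] by (simp add: pq algebra_simps)
  qed simp
  \<comment> \<open>\<open>C1\<close> contains \<open>(0, e)\<close> for every \<open>e > 0\<close>,
    so the separating constant may be taken to be 0.\<close>
  have "0 \<le> - c"
  proof (rule nonneg_of_poly_nonneg[where r=1 and ?c1.0 = q and ?c2.0 = 0])
    fix e :: real assume "0 < e"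
    then show "0 \<le> - c + q * e + 0 * e\<^sup>2"
      using nC1[OF C1I[of 0 0 e]] by (simp add: pq)
  qed simp
  then have pC2: "p \<bullet> y \<le> q * Q y" if "b \<bullet> y = - 1" for y
    using nC2[of "(y, - Q y)"] that by (simp add: C2_def pq)
  \<comment> \<open>The Slater point excludes a vertical hyperplane: \<open>xh\<close> is interior
    to the ball, so \<open>e - r *\<^sub>R p\<close> stays in the translated ball, which makes
    \<open>p \<bullet> e\<close> positive, while \<open>C2\<close> makes it nonpositive.\<close>
  have "q \<noteq> 0"
  proof
    assume q: "q = 0"
    then have p: "p \<noteq> 0" using n by (simp add: pq zero_prod_def)
    define r where "r = (1 - norm xh) / norm p"
    have r: "0 < r" "r * norm p = 1 - norm xh" using xh p by (auto simp: r_def)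
    have "norm (xh - r *\<^sub>R p) \<le> norm xh + norm (r *\<^sub>R p)" by (rule norm_triangle_ineq4)
    then have "norm ((e - r *\<^sub>R p) + 1 *\<^sub>R xs) \<le> 1" using r by (simp add: e_def algebra_simps)
    from pC1[OF this] have "r * (p \<bullet> p) \<le> p \<bullet> e" using q by (simp add: inner_diff_right)
    moreover have "0 < r * (p \<bullet> p)" using r p by simp
    moreover have "p \<bullet> e \<le> 0"
    proof -
      have "p \<bullet> e' \<le> 0" using pC2[OF be'] q by simp
      moreover have "e = - (b \<bullet> e) *\<^sub>R e'" using be by (simp add: e'_def)
      then have "p \<bullet> e = - (b \<bullet> e) * (p \<bullet> e')" by (metis inner_scaleR_right)
      ultimately show ?thesis using be by (simp add: mult_nonpos_nonpos mult_le_0_iff)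
    qed
    ultimately show False by linarith
  qed
  then have q: "0 < q" using q0 by simp
  define u where "u = (1 / q) *\<^sub>R p"
  have pu: "p = q *\<^sub>R u" using q by (simp add: u_def)
  have uC1: "0 \<le> u \<bullet> y + \<tau> * \<nu>" if "norm (y + \<tau> *\<^sub>R xs) \<le> \<tau>" for y \<tau>
  proof -
    have "0 \<le> q * (u \<bullet> y + \<tau> * \<nu>)" using pC1[OF that] by (simp add: pu algebra_simps)
    then show ?thesis using q by (simp add: zero_le_mult_iff)
  qed
  have "norm u + u \<bullet> xs \<le> \<nu>"
  proof (cases "u = 0")
    case False
    \<comment> \<open>The bound is tested at the point of the translated ball where \<open>u\<close>
      is smallest, with \<open>\<tau> = 1\<close>.\<close>
    have "0 \<le> u \<bullet> (- (1 / norm u) *\<^sub>R u - xs) + 1 * \<nu>" using False by (intro uC1) simp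
    moreover have "u \<bullet> (- (1 / norm u) *\<^sub>R u) = - norm u"
      using False by (simp add: power2_norm_eq_inner[symmetric] power2_eq_square)
    ultimately show ?thesis by (simp only: inner_diff_right)
  qed (use nu in simp)
  moreover have "0 \<le> Q y + (b \<bullet> y) * (u \<bullet> y)" for y
  proof (cases "b \<bullet> y = 0")
    case False
    \<comment> \<open>Rescaling to \<open>b \<bullet> y = - 1\<close>; a negative \<open>t\<close>
      is harmless, every term being homogeneous of degree 2.\<close>
    define t where "t = 1 / - (b \<bullet> y)"
    have t: "t * (b \<bullet> y) = - 1" "t \<noteq> 0" using False by (auto simp: t_def)
    have "q * (u \<bullet> (t *\<^sub>R y)) \<le> q * Q (t *\<^sub>R y)"
      using pC2[of "t *\<^sub>R y"] t by (simp add: pu mult.left_commute)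
    then have "0 \<le> Q (t *\<^sub>R y) - u \<bullet> (t *\<^sub>R y)" using q by simp
    also have "\<dots> = t\<^sup>2 * Q y + (t * (b \<bullet> y)) * (t * (u \<bullet> y))" unfolding t Qscale by simp
    also have "\<dots> = t\<^sup>2 * (Q y + (b \<bullet> y) * (u \<bullet> y))" by (simp add: algebra_simps power2_eq_square)
    finally show ?thesis using t(2) by (simp add: zero_le_mult_iff)
  qed (use psd in \<open>simp add: Q_def\<close>)
  ultimately show ?thesis unfolding Q_def by blast
qed

text \<open>If the shifted form is nonnegative orthogonally to \<open>b\<close>, the separation
  supplies \<open>u\<close>, and \<open>b \<bullet> xs = \<beta>\<close> removes the term of (i)
  along \<open>u\<close>. The other case reduces to the ball constraint alone.\<close>

lemma certificate_active:
  assumes active: "b \<bullet> xs = \<beta>"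
  shows "\<exists>l0 u0 u. certificate l0 u0 u"
proof -
  obtain \<mu> \<nu> where st: "stationary \<mu> \<nu>"
    using kkt unfolding stationary_def by metis
  obtain xh where xh: "norm xh < 1" "b \<bullet> xh < \<beta>" using slater by blast
  have bxh: "b \<bullet> (xh - xs) < 0" using xh active by (simp add: inner_diff_right)
  have ?thesis if psd: "\<And>d. b \<bullet> d = 0 \<Longrightarrow> 0 \<le> d \<bullet> L d + \<mu> * (d \<bullet> d)"
  proof -
    obtain u where u: "norm u + u \<bullet> xs \<le> \<nu>" "\<And>y. 0 \<le> y \<bullet> L y + \<mu> * (y \<bullet> y) + (b \<bullet> y) * (u \<bullet> y)"
      using separating_multiplier[OF st active psd] by blast
    have "certificate \<mu> (u \<bullet> xs - \<nu>) u"
      using st u active by (simp add: certificate_def stationary_def)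
    then show ?thesis by blast
  qed
  moreover have ?thesis if neg: "\<not> (\<forall>d. b \<bullet> d = 0 \<longrightarrow> 0 \<le> d \<bullet> L d + \<mu> * (d \<bullet> d))"
  proof -
    \<comment> \<open>Here \<open>b\<close> is a positive multiple of \<open>xs\<close>, so the linear constraint is implied by the ball
      and \<open>\<nu>\<close> can be moved into \<open>\<mu>\<close>.\<close>
    have xs1: "norm xs = 1"
      using form_nonneg_interior[OF st] neg norm_xs by (meson less_eq_real_def)
    \<comment> \<open>Otherwise \<open>w\<close> would be a transversal direction making the form
      nonnegative on the whole orthogonal complement of \<open>b\<close>.\<close>
    have par: "xs \<bullet> w = 0" if w: "b \<bullet> w = 0" for w
    proof (rule ccontr)
      assume "xs \<bullet> w \<noteq> 0"
      then show False
        using form_nonneg_on_subspace[OF st xs1 subspace_hyperplane, of b w] w neg by auto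
    qed
    define c where "c = (b \<bullet> xs) / (b \<bullet> b)"
    have "b \<noteq> 0" using bxh by auto
    then have "b \<bullet> (xs - c *\<^sub>R b) = 0" by (simp add: c_def inner_diff_right)
    then have "(xs - c *\<^sub>R b) \<bullet> (xs - c *\<^sub>R b) = 0"
      using par by (simp add: inner_diff_left)
    then have xc: "xs = c *\<^sub>R b" by simp
    have "xs \<bullet> xh \<le> norm xs * norm xh" by (rule norm_cauchy_schwarz)
    then have "xs \<bullet> (xh - xs) < 0"
      using xh xs1 by (simp add: inner_diff_right norm_eq_1)
    moreover have "xs \<bullet> (xh - xs) = c * (b \<bullet> (xh - xs))"
      by (subst (1) xc) simp
    ultimately have "c * (b \<bullet> (xh - xs)) < 0" by simp
    then have c: "0 < c" using bxh by (simp add: mult_less_0_iff)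
    have "\<nu> *\<^sub>R b = (\<nu> / c) *\<^sub>R xs" using c by (simp add: xc)
    then have st': "stationary (\<mu> + \<nu> / (2 * c)) 0"
      using st c xs1 by (simp add: stationary_def algebra_simps)
    have "b \<bullet> d \<le> 0" if "xs \<bullet> d < 0" for d
      using that c by (simp add: xc mult_less_0_iff)
    then have "0 \<le> d \<bullet> L d + (\<mu> + \<nu> / (2 * c)) * (d \<bullet> d)" for d
      using xs1 by (intro form_nonneg_on_subspace[OF st' xs1 subspace_UNIV, of xs]) auto
    then show ?thesis using certificate_if_psd[OF st'] by blast
  qed
  ultimately show ?thesis by blast
qed

end

section \<open>Matrix form and the equivalence\<close>

lemma outer_mult_vec: "outer v w *v x = (w \<bullet> x) *\<^sub>R v"
  by (simp add: outer_def matrix_vector_mult_def inner_vec_def vec_eq_iff sum_distrib_left mult_ac)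

lemma etrs_matrix_mult_vec:
  "(2 *\<^sub>R A + (2 * l0) *\<^sub>R mat 1 + outer b u + outer u b) *v x =
    2 *\<^sub>R (A *v x) + (2 * l0) *\<^sub>R x + (u \<bullet> x) *\<^sub>R b + (b \<bullet> x) *\<^sub>R u"
  by (simp add: matrix_vector_mult_add_rdistrib outer_mult_vec flip: scaleR_matrix_vector_assoc)

lemma pos_semidef_etrs_matrix_iff:
  assumes "symmetric_mat A"
  shows "pos_semidef (2 *\<^sub>R A + (2 * l0) *\<^sub>R mat 1 + outer b u + outer u b) \<longleftrightarrow>
    (\<forall>y. 0 \<le> y \<bullet> (A *v y) + l0 * (y \<bullet> y) + (b \<bullet> y) * (u \<bullet> y))"
proof -
  have "symmetric_mat (2 *\<^sub>R A + (2 * l0) *\<^sub>R mat 1 + outer b u + outer u b)"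
    using assms by (auto simp: symmetric_mat_def transpose_def outer_def mat_def vec_eq_iff)
  moreover have "y \<bullet> ((2 *\<^sub>R A + (2 * l0) *\<^sub>R mat 1 + outer b u + outer u b) *v y) =
      2 * (y \<bullet> (A *v y) + l0 * (y \<bullet> y) + (b \<bullet> y) * (u \<bullet> y))" for y
    unfolding etrs_matrix_mult_vec by (simp add: inner_add_right inner_commute[of y b] inner_commute[of y u] algebra_simps)
  ultimately show ?thesis
    unfolding pos_semidef_def by (simp only: zero_le_mult_iff) simp
qed

theorem theorem2p1:
  fixes A :: "real^'n^'n" and a b xs :: "real^'n" and \<beta> :: real
  assumes "symmetric_mat A" and "indefinite A"
    and "\<exists>xh :: real^'n. (norm xh)\<^sup>2 - 1 < 0 \<and> b \<bullet> xh - \<beta> < 0"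
    and "etrs_feasible b \<beta> xs"
  shows "is_arg_min (etrs_objective A a) (etrs_feasible b \<beta>) xs \<longleftrightarrow>
    (\<exists>(l0::real) (u0::real) (u::real^'n).
       l0 \<ge> 0 \<and> (- u0, u) \<in> lorentz_cone \<and>
       (2 *\<^sub>R A + (2 * l0) *\<^sub>R mat 1 + outer b u + outer u b) *v xs
         = - (2 *\<^sub>R a - \<beta> *\<^sub>R u - u0 *\<^sub>R b) \<and>
       l0 * ((norm xs)\<^sup>2 - 1) = 0 \<and> (u \<bullet> xs - u0) * (b \<bullet> xs - \<beta>) = 0 \<and>
       pos_semidef (2 *\<^sub>R A + (2 * l0) *\<^sub>R mat 1 + outer b u + outer u b))"
    (is "?min \<longleftrightarrow> (\<exists>l0 u0 u. ?cert l0 u0 u)")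
proof
  have sym: "x \<bullet> (A *v y) = (A *v x) \<bullet> y" for x y
    by (metis assms(1) symmetric_mat_def dot_lmul_matrix transpose_matrix_vector)
  have feas: "etrs_feasible b \<beta> x \<longleftrightarrow> norm x \<le> 1 \<and> b \<bullet> x \<le> \<beta>" for x
    by (simp add: etrs_feasible_def abs_square_le_1)
  show "\<exists>l0 u0 u. ?cert l0 u0 u" if ?min
  proof -
    interpret extended_trs "(*v) A" a b xs \<beta>
      using that assms(3,4) sym
      by (intro extended_trs.intro)
        (auto simp: is_arg_min_linorder feas etrs_objective_def abs_square_less_1 matrix_vector_mul_linear)
    obtain l0 u0 u where "certificate l0 u0 u"
      using certificate_active certificate_inactive b_xs by fastforce
    then have "?cert l0 u0 u"
      unfolding pos_semidef_etrs_matrix_iff[OF assms(1)] etrs_matrix_mult_vec certificate_def lorentz_cone_def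
      by (auto simp: algebra_simps eq_neg_iff_add_eq_0)
    then show ?thesis by blast
  qed
  show ?min if cert: "\<exists>l0 u0 u. ?cert l0 u0 u"
  proof -
    obtain l0 u0 u where "?cert l0 u0 u" using cert by blast
    then have l0: "0 \<le> l0" and cone: "norm u \<le> - u0"
      and grad: "2 *\<^sub>R (A *v xs) + (2 * l0) *\<^sub>R xs + (u \<bullet> xs) *\<^sub>R b + (b \<bullet> xs) *\<^sub>R u = - (2 *\<^sub>R a - \<beta> *\<^sub>R u - u0 *\<^sub>R b)"
      and comp: "l0 * ((norm xs)\<^sup>2 - 1) = 0" "(u \<bullet> xs - u0) * (b \<bullet> xs - \<beta>) = 0"
      and psd: "\<And>y. 0 \<le> y \<bullet> (A *v y) + l0 * (y \<bullet> y) + (b \<bullet> y) * (u \<bullet> y)"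
      unfolding pos_semidef_etrs_matrix_iff[OF assms(1)] etrs_matrix_mult_vec lorentz_cone_def by auto
    have "etrs_objective A a xs \<le> etrs_objective A a x" if "etrs_feasible b \<beta> x" for x
    proof -
      have x: "norm x \<le> 1" "b \<bullet> x \<le> \<beta>" using that feas by auto
      define d where "d = x - xs"
      have xd: "x = xs + d" by (simp add: d_def)
      have "d \<bullet> (2 *\<^sub>R (A *v xs) + (2 * l0) *\<^sub>R xs + (u \<bullet> xs) *\<^sub>R b + (b \<bullet> xs) *\<^sub>R u) =
          d \<bullet> (- (2 *\<^sub>R a - \<beta> *\<^sub>R u - u0 *\<^sub>R b))" by (simp add: grad)
      then have g: "2 * (xs \<bullet> (A *v d)) + 2 * l0 * (xs \<bullet> d) + (u \<bullet> xs) * (b \<bullet> d) + (b \<bullet> xs) * (u \<bullet> d) + 2 * (a \<bullet> d) =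
          \<beta> * (u \<bullet> d) + u0 * (b \<bullet> d)"
        by (simp add: inner_simps inner_commute[of d "A *v xs"] inner_commute[of d xs]
            inner_commute[of d a] inner_commute[of d b] inner_commute[of d u] flip: sym)
      \<comment> \<open>Exact second-order expansion of the Lagrangian at \<open>xs\<close>: the
        linear term vanishes by \<open>g\<close>, and half of the form in (iii) remains.\<close>
      have lag: "etrs_objective A a x + l0 * ((norm x)\<^sup>2 - 1) + (u \<bullet> x - u0) * (b \<bullet> x - \<beta>) =
          etrs_objective A a xs + l0 * ((norm xs)\<^sup>2 - 1) + (u \<bullet> xs - u0) * (b \<bullet> xs - \<beta>) +
          (d \<bullet> (A *v d) + l0 * (d \<bullet> d) + (b \<bullet> d) * (u \<bullet> d))"
        using g unfolding xd etrs_objective_def power2_norm_eq_inner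
        by (simp add: inner_simps matrix_vector_right_distrib inner_commute[of d "A *v xs"]
            inner_commute[of d xs] flip: sym)
          (simp add: algebra_simps)
      \<comment> \<open>Cauchy-Schwarz and the cone condition give
        \<open>u \<bullet> x - u0 \<ge> 0\<close> on the unit ball, so the product term is
        nonpositive on the feasible set.\<close>
      have "- (u \<bullet> x) \<le> norm u * norm x"
        using norm_cauchy_schwarz[of "- u" x] by simp
      also have "\<dots> \<le> norm u" using x by (simp add: mult_left_le)
      finally have "0 \<le> u \<bullet> x - u0" using cone by simp
      then have "(u \<bullet> x - u0) * (b \<bullet> x - \<beta>) \<le> 0" using x by (simp add: mult_nonneg_nonpos)
      moreover have "l0 * ((norm x)\<^sup>2 - 1) \<le> 0"
        using x l0 by (simp add: mult_nonneg_nonpos abs_square_le_1)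
      ultimately show ?thesis using lag psd[of d] unfolding comp by linarith
    qed
    then show ?thesis using assms(4) by (simp add: is_arg_min_linorder)
  qed
qed

end
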